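(* Let $\mathbb{F}$ be a field of characteristic $p>2$, let $(A,L,[\cdot,\cdot],(\cdot)^{[p]},\rho)$ be a restricted Lie-Rinehart algebra over $\mathbb{F}$, and let $(m,\omega)=([\cdot,\cdot],(\cdot)^{[p]})$ be the associated restricted multiderivation (with symbol map $\rho$). Let $(m_t,\omega_t)$, $m_t=\sum_{i\ge 0}t^im_i$, $\omega_t=\sum_{i\ge 0}t^i\omega_i$, be a restricted formal deformation of $(m,\omega)$. Then $(m_1,\omega_1)$ is a $2$-cocycle of the restricted cohomology of $L$ with adjoint coefficients, i.e. $(m_1,\omega_1)\in C^2_*(L,L)$ and $d^2_*(m_1,\omega_1)=0$.
   Context: All algebras are finite-dimensional. **Restricted Lie algebra.** A Lie algebra $L$ over $\mathbb F$ with a map $(\cdot)^{[p]}:L\to L$ such that $(\lambda x)^{[p]}=\lambda^px^{[p]}$, $[x,y^{[p]}]=[[\cdots[x,y],y],\cdots,y]$ ($p$ copies of $y$), and $(x+y)^{[p]}=x^{[p]}+y^{[p]}+\sum_{i=1}^{p-1}s_i(x,y)$, where $i\,s_i(x,y)$ is the coefficient of $Z^{i-1}$ in $\mathrm{ad}_{Zx+y}^{p-1}(x)$. **Restricted Lie-Rinehart algebra.** $A$ is a commutative associative $\mathbb F$-algebra, $L$ is a restricted Lie algebra and an $A$-module, and $\rho:L\to \mathrm{Der}(A)$ (the anchor) is a morphism of Lie algebras and of $A$-modules with $[x,ay]=\rho(x)(a)y+a[x,y]$, $\rho(x^{[p]})=\rho(x)^p$ and $(ax)^{[p]}=a^px^{[p]}+\rho(ax)^{p-1}(a)x$.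 **Restricted multiderivation (of order 1).** A pair $(m,\omega)$ with $m:L\times L\to L$ skew-symmetric bilinear, $\omega:L\to L$ with $\omega(\lambda x)=\lambda^p\omega(x)$ and $\omega(x+y)=\omega(x)+\omega(y)+\sum_{i=1}^{p-1}\theta_i(x,y)$, where $i\theta_i(x,y)$ is the coefficient of $Z^{i-1}$ in $(\widetilde{\mathrm{ad}}_m(Zx+y))^{p-1}(x)$, $\widetilde{\mathrm{ad}}_m(x)(y)=m(x,y)$, such that there is a map $\sigma:L\to\mathrm{Der}(A)$ (symbol map) with $\sigma(ax)=a\sigma(x)$, $m(x,ay)=am(x,y)+\sigma(x)(a)y$, $\sigma(\omega(x))=\sigma(x)^p$, $\omega(ax)=a^p\omega(x)+\sigma(ax)^{p-1}(a)x$. **Restricted formal deformation of $(m,\omega)$.** Maps $m_t=\sum_{i\ge0}t^im_i$, $\omega_t=\sum_{j\ge0}t^j\omega_j$ with $m_0=m$, $\omega_0=\omega$ and each $(m_i,\omega_i)$ a restricted multiderivation with symbol map $\sigma_i$ ($\sigma_0=\rho$), such that for all $x,y,z\in L$, $a\in A$: (1) $m_t(x,m_t(y,z))+m_t(y,m_t(z,x))+m_t(z,m_t(x,y))=0$; (2) $m_t(x,\omega_t(y))=m_t(m_t(\cdots m_t(x,y),y),\cdots,y)$ ($p$ copies of $y$ on the right); (3) $\sum_{i=0}^k\sigma_i(\omega_{k-i}(x))(a)=\sum_{i_1+\cdots+i_p=k}\sigma_{i_1}(x)\circ\cdots\circ\sigma_{i_p}(x)(a)$ for all $k\ge0$; (4)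 $\sigma_k(x)^{p-1}=\sum_{i_1+\cdots+i_{p-1}=k}\sigma_{i_1}(x)\circ\cdots\circ\sigma_{i_{p-1}}(x)$ for all $k\ge 0$. Here $m_t$ is extended $\mathbb F[[t]]$-bilinearly to $L[[t]]$, and $\omega_t$ is extended to $L[[t]]$ by $p$-homogeneity and by $\omega_t(x+y)=\omega_t(x)+\omega_t(y)+\sum_{k=1}^{p-1}s_k^t(x,y)$, where $k\,s^t_k(x,y)$ is the coefficient of $Z^{k-1}$ in $(\widetilde{\mathrm{ad}}_{m_t}(Zx+y))^{p-1}(x)$; this formula also holds for $x,y\in L$ (so $(L[[t]],m_t,\omega_t)$ is a restricted Lie algebra). **Restricted cohomology (adjoint coefficients).** $L$ acts on itself by $y\cdot x=[y,x]$. $C^m_{CE}(L,L)$ is the space of alternating $m$-linear maps $L^m\to L$, and for $\varphi\in C^2_{CE}(L,L)$ $$d^2_{CE}\varphi(x,y,z)=\varphi([x,y],z)-\varphi([x,z],y)+\varphi([y,z],x)-[x,\varphi(y,z)]+[y,\varphi(x,z)]-[z,\varphi(x,y)].$$ $C^2_*(L,L)$ is the set of pairs $(\varphi,w)$ with $\varphi\in C^2_{CE}(L,L)$ and $w:L\to L$ satisfying $w(\lambda x)=\lambda^pw(x)$ and $$w(x+y)=w(x)+w(y)+\sum_{x_i\in\{x,y\},\,x_1=x,\,x_2=y}\frac1{\sharp\{x\}}\sum_{k=0}^{p-2}(-1)^kx_p\cdots x_{p-k+1}\varphi([[\cdots[x_1,x_2],x_3]\cdots,x_{p-k-1}],x_{p-k}),$$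 where the outer sum is over sequences $(x_1,\dots,x_p)$, $\sharp\{x\}$ is the number of $i$ with $x_i=x$, the product $x_p\cdots x_{p-k+1}$ denotes iterated action (empty for $k=0$), and for $k=p-2$ the bracket is just $x_1$. Finally $d^2_*(\varphi,w)=(d^2_{CE}\varphi,\mathrm{ind}^2(\varphi,w))$ with $$\mathrm{ind}^2(\varphi,w)(x,y)=\varphi(x,y^{[p]})-\sum_{i+j=p-1}(-1)^iy^i\cdot\varphi([\cdots[x,\underbrace{y],\cdots,y}_{j}],y)+x\cdot w(y),$$ $i,j\geq 0$, $y^i\cdot$ denoting the $i$-fold action. *)

theory Defs
  imports "HOL-Computational_Algebra.Computational_Algebra"
begin

definition finite_dimensional :: "('k::field \<Rightarrow> 'v::ab_group_add \<Rightarrow> 'v) \<Rightarrow> bool" where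
  "finite_dimensional scale \<longleftrightarrow> (\<exists>B. finite_dimensional_vector_space scale B)"

definition bilinear_map ::
  "('k::field \<Rightarrow> 'v::ab_group_add \<Rightarrow> 'v) \<Rightarrow> ('v \<Rightarrow> 'v \<Rightarrow> 'v) \<Rightarrow> bool" where
  "bilinear_map scale m \<longleftrightarrow>
     (\<forall>x. Vector_Spaces.linear scale scale (\<lambda>y. m x y)) \<and>
     (\<forall>y. Vector_Spaces.linear scale scale (\<lambda>x. m x y))"

text \<open>The extension of a bilinear \<open>m\<close> on \<open>V\<close> to \<open>V[Z]\<close>, bilinear over polynomials in \<open>Z\<close>.\<close>

definition poly_extend ::
  "('v::ab_group_add \<Rightarrow> 'v \<Rightarrow> 'v) \<Rightarrow> 'v poly \<Rightarrow> 'v poly \<Rightarrow> 'v poly" where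
  "poly_extend m f g =
     (\<Sum>i\<le>degree f. \<Sum>j\<le>degree g. monom (m (coeff f i) (coeff g j)) (i + j))"

text \<open>
  \<open>i\<close> times this element is the coefficient of \<open>Z\<^sup>i\<^sup>-\<^sup>1\<close> in \<open>ad\<^sub>m(Zx + y)\<^sup>p\<^sup>-\<^sup>1(x)\<close>, for \<open>1 \<le> i < p\<close>.
  The scalars need not form a field, because the formula is also used over the power series
  ring \<open>F[[t]]\<close>, where \<open>inverse (of_nat i)\<close> is the constant series \<open>1/i\<close>.
\<close>

definition jacobson_term ::
  "('r::{comm_ring_1,inverse} \<Rightarrow> 'v::ab_group_add \<Rightarrow> 'v) \<Rightarrow> ('v \<Rightarrow> 'v \<Rightarrow> 'v) \<Rightarrow>
   nat \<Rightarrow> nat \<Rightarrow> 'v \<Rightarrow> 'v \<Rightarrow> 'v" where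
  "jacobson_term scale m p i x y =
     scale (inverse (of_nat i)) (coeff ((poly_extend m [:y, x:] ^^ (p - 1)) [:x:]) (i - 1))"

definition p_map_wrt ::
  "('r::{comm_ring_1,inverse} \<Rightarrow> 'v::ab_group_add \<Rightarrow> 'v) \<Rightarrow> ('v \<Rightarrow> 'v \<Rightarrow> 'v) \<Rightarrow>
   nat \<Rightarrow> ('v \<Rightarrow> 'v) \<Rightarrow> bool" where
  "p_map_wrt scale m p w \<longleftrightarrow>
     (\<forall>c x. w (scale c x) = scale (c ^ p) (w x)) \<and>
     (\<forall>x y. w (x + y) = w x + w y + (\<Sum>i=1..p-1. jacobson_term scale m p i x y))"

locale lie_algebra = vector_space scale
  for scale :: "'k::field \<Rightarrow> 'l::ab_group_add \<Rightarrow> 'l" +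
  fixes br :: "'l \<Rightarrow> 'l \<Rightarrow> 'l"
  assumes br_bilinear: "bilinear_map scale br"
    and br_alternating: "br x x = 0"
    and br_jacobi: "br x (br y z) + br y (br z x) + br z (br x y) = 0"

locale restricted_lie_algebra = lie_algebra scale br
  for scale :: "'k::field \<Rightarrow> 'l::ab_group_add \<Rightarrow> 'l" and br +
  fixes p :: nat and pm :: "'l \<Rightarrow> 'l"
  assumes pm_p_map: "p_map_wrt scale br p pm"
    and br_pm: "br x (pm y) = ((\<lambda>u. br u y) ^^ p) x"

text \<open>Commutative associative algebras are not assumed to be unital, and may be zero.\<close>

locale commutative_algebra = vector_space sA
  for sA :: "'k::field \<Rightarrow> 'a::comm_ring \<Rightarrow> 'a" +
  assumes sA_mult: "sA c (a * b) = sA c a * b"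

text \<open>The power \<open>a\<^sup>n\<close> for \<open>n \<ge> 1\<close>; the library's power operation requires a unit.\<close>

definition nonunital_power :: "'a::comm_ring \<Rightarrow> nat \<Rightarrow> 'a" where
  "nonunital_power a n = ((\<lambda>b. a * b) ^^ (n - 1)) a"

lemma nonunital_power_eq_power:
  fixes a :: "'a::comm_ring_1"
  assumes "n > 0"
  shows "nonunital_power a n = a ^ n"
proof -
  have "((\<lambda>b. a * b) ^^ k) a = a ^ Suc k" for k
    by (induction k) simp_all
  from this[of "n - 1"] show ?thesis
    using assms by (simp add: nonunital_power_def)
qed

locale algebra_module = A: commutative_algebra sA + L: vector_space sL
  for sA :: "'k::field \<Rightarrow> 'a::comm_ring \<Rightarrow> 'a" and sL :: "'k \<Rightarrow> 'l::ab_group_add \<Rightarrow> 'l" +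
  fixes act :: "'a \<Rightarrow> 'l \<Rightarrow> 'l"
  assumes act_add_left: "act (a + b) x = act a x + act b x"
    and act_add_right: "act a (x + y) = act a x + act a y"
    and act_mult: "act (a * b) x = act a (act b x)"
    and act_scale_left: "act (sA c a) x = sL c (act a x)"
    and act_scale_right: "act a (sL c x) = sL c (act a x)"

definition derivation :: "('k::field \<Rightarrow> 'a::comm_ring \<Rightarrow> 'a) \<Rightarrow> ('a \<Rightarrow> 'a) \<Rightarrow> bool" where
  "derivation sA D \<longleftrightarrow>
     Vector_Spaces.linear sA sA D \<and> (\<forall>a b. D (a * b) = D a * b + a * D b)"

locale restricted_lie_rinehart_algebra =
  algebra_module sA sL act + restricted_lie_algebra sL br p pm
  for sA :: "'k::field \<Rightarrow> 'a::comm_ring \<Rightarrow> 'a"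
    and sL :: "'k \<Rightarrow> 'l::ab_group_add \<Rightarrow> 'l"
    and act :: "'a \<Rightarrow> 'l \<Rightarrow> 'l"
    and br :: "'l \<Rightarrow> 'l \<Rightarrow> 'l"
    and p :: nat
    and pm :: "'l \<Rightarrow> 'l" +
  fixes \<rho> :: "'l \<Rightarrow> 'a \<Rightarrow> 'a"
  assumes anchor_derivation: "derivation sA (\<rho> x)"
    and anchor_add: "\<rho> (x + y) a = \<rho> x a + \<rho> y a"
    and anchor_scale: "\<rho> (sL c x) a = sA c (\<rho> x a)"
    and anchor_act: "\<rho> (act b x) a = b * \<rho> x a"
    and anchor_br: "\<rho> (br x y) a = \<rho> x (\<rho> y a) - \<rho> y (\<rho> x a)"
    and br_act: "br x (act a y) = act (\<rho> x a) y + act a (br x y)"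
    and anchor_pm: "\<rho> (pm x) a = (\<rho> x ^^ p) a"
    and pm_act: "pm (act a x) =
      act (nonunital_power a p) (pm x) + act ((\<rho> (act a x) ^^ (p - 1)) a) x"

text \<open>\<open>(m, \<omega>)\<close> is a restricted multiderivation (of order 1) with symbol map \<open>\<sigma>\<close>.\<close>

definition restricted_multiderivation ::
  "('k::field \<Rightarrow> 'a::comm_ring \<Rightarrow> 'a) \<Rightarrow> ('k \<Rightarrow> 'l::ab_group_add \<Rightarrow> 'l) \<Rightarrow>
   ('a \<Rightarrow> 'l \<Rightarrow> 'l) \<Rightarrow> nat \<Rightarrow>
   ('l \<Rightarrow> 'l \<Rightarrow> 'l) \<Rightarrow> ('l \<Rightarrow> 'l) \<Rightarrow> ('l \<Rightarrow> 'a \<Rightarrow> 'a) \<Rightarrow> bool" where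
  "restricted_multiderivation sA sL act p m \<omega> \<sigma> \<longleftrightarrow>
     bilinear_map sL m \<and> (\<forall>x y. m x y = - m y x) \<and>
     p_map_wrt sL m p \<omega> \<and>
     (\<forall>x. derivation sA (\<sigma> x)) \<and>
     (\<forall>a x b. \<sigma> (act a x) b = a * \<sigma> x b) \<and>
     (\<forall>x a y. m x (act a y) = act a (m x y) + act (\<sigma> x a) y) \<and>
     (\<forall>x a. \<sigma> (\<omega> x) a = (\<sigma> x ^^ p) a) \<and>
     (\<forall>a x. \<omega> (act a x) =
        act (nonunital_power a p) (\<omega> x) + act ((\<sigma> (act a x) ^^ (p - 1)) a) x)"

definition fps_scale ::
  "('k::field \<Rightarrow> 'l::ab_group_add \<Rightarrow> 'l) \<Rightarrow> 'k fps \<Rightarrow> 'l fps \<Rightarrow> 'l fps" where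
  "fps_scale sL c f = Abs_fps (\<lambda>n. \<Sum>i\<le>n. sL (fps_nth c i) (fps_nth f (n - i)))"

text \<open>The \<open>F[[t]]\<close>-bilinear extension of \<open>m\<^sub>t = \<Sum> t\<^sup>i m\<^sub>i\<close> to \<open>L[[t]]\<close>.\<close>

definition m_series ::
  "(nat \<Rightarrow> 'l::ab_group_add \<Rightarrow> 'l \<Rightarrow> 'l) \<Rightarrow> 'l fps \<Rightarrow> 'l fps \<Rightarrow> 'l fps" where
  "m_series ms f g =
     Abs_fps (\<lambda>n. \<Sum>i\<le>n. \<Sum>j\<le>n - i. ms i (fps_nth f j) (fps_nth g (n - i - j)))"

definition w_series :: "(nat \<Rightarrow> 'l \<Rightarrow> 'l) \<Rightarrow> 'l \<Rightarrow> 'l fps" where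
  "w_series ws x = Abs_fps (\<lambda>j. ws j x)"

text \<open>The sum of \<open>\<sigma>\<^sub>i\<^sub>1(x) \<circ> \<dots> \<circ> \<sigma>\<^sub>i\<^sub>n(x)\<close> over all \<open>i\<^sub>1 + \<dots> + i\<^sub>n = k\<close> in the naturals, evaluated at \<open>a\<close>.\<close>

definition symbol_convolution ::
  "(nat \<Rightarrow> 'l \<Rightarrow> 'a \<Rightarrow> 'a::comm_ring) \<Rightarrow> nat \<Rightarrow> nat \<Rightarrow> 'l \<Rightarrow> 'a \<Rightarrow> 'a" where
  "symbol_convolution \<sigma> n k x a =
     (\<Sum>is\<in>{is::nat list. length is = n \<and> sum_list is = k}. foldr (\<lambda>i. \<sigma> i x) is a)"

text \<open>
  In the last conjunct, \<open>\<Omega>\<close> is the extension of \<open>\<omega>\<^sub>t\<close> to \<open>L[[t]]\<close>; applied to constant series,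
  its additivity formula gives the one for \<open>\<omega>\<^sub>t(x + y)\<close> with \<open>x, y \<in> L\<close>.
\<close>

definition restricted_formal_deformation ::
  "('k::field \<Rightarrow> 'a::comm_ring \<Rightarrow> 'a) \<Rightarrow> ('k \<Rightarrow> 'l::ab_group_add \<Rightarrow> 'l) \<Rightarrow>
   ('a \<Rightarrow> 'l \<Rightarrow> 'l) \<Rightarrow> nat \<Rightarrow>
   ('l \<Rightarrow> 'l \<Rightarrow> 'l) \<Rightarrow> ('l \<Rightarrow> 'l) \<Rightarrow> ('l \<Rightarrow> 'a \<Rightarrow> 'a) \<Rightarrow>
   (nat \<Rightarrow> 'l \<Rightarrow> 'l \<Rightarrow> 'l) \<Rightarrow> (nat \<Rightarrow> 'l \<Rightarrow> 'l) \<Rightarrow> bool" where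
  "restricted_formal_deformation sA sL act p m \<omega> \<rho> ms ws \<longleftrightarrow>
     ms 0 = m \<and> ws 0 = \<omega> \<and>
     (\<exists>\<sigma>. \<sigma> 0 = \<rho> \<and>
        (\<forall>i. restricted_multiderivation sA sL act p (ms i) (ws i) (\<sigma> i)) \<and>
        (\<forall>k x a. (\<Sum>i\<le>k. \<sigma> i (ws (k - i) x) a) = symbol_convolution \<sigma> p k x a) \<and>
        (\<forall>k x a. (\<sigma> k x ^^ (p - 1)) a = symbol_convolution \<sigma> (p - 1) k x a)) \<and>
     (\<forall>x y z.
        m_series ms (fps_const x) (m_series ms (fps_const y) (fps_const z)) +
        m_series ms (fps_const y) (m_series ms (fps_const z) (fps_const x)) +
        m_series ms (fps_const z) (m_series ms (fps_const x) (fps_const y)) = 0) \<and>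
     (\<forall>x y. m_series ms (fps_const x) (w_series ws y) =
        ((\<lambda>u. m_series ms u (fps_const y)) ^^ p) (fps_const x)) \<and>
     (\<exists>\<Omega>. (\<forall>x. \<Omega> (fps_const x) = w_series ws x) \<and>
        p_map_wrt (fps_scale sL) (m_series ms) p \<Omega>)"

definition C2_CE ::
  "('k::field \<Rightarrow> 'l::ab_group_add \<Rightarrow> 'l) \<Rightarrow> ('l \<Rightarrow> 'l \<Rightarrow> 'l) set" where
  "C2_CE sL = {\<phi>. bilinear_map sL \<phi> \<and> (\<forall>x. \<phi> x x = 0)}"

definition d2_CE ::
  "('l::ab_group_add \<Rightarrow> 'l \<Rightarrow> 'l) \<Rightarrow> ('l \<Rightarrow> 'l \<Rightarrow> 'l) \<Rightarrow> 'l \<Rightarrow> 'l \<Rightarrow> 'l \<Rightarrow> 'l" where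
  "d2_CE br \<phi> x y z =
     \<phi> (br x y) z - \<phi> (br x z) y + \<phi> (br y z) x
     - br x (\<phi> y z) + br y (\<phi> x z) - br z (\<phi> x y)"

text \<open>
  For \<open>xs = [x\<^sub>1, \<dots>, x\<^sub>p]\<close>, the sum over \<open>k = 0, \<dots>, p - 2\<close> of
  \<open>(-1)\<^sup>k x\<^sub>p \<cdots> x\<^sub>p\<^sub>-\<^sub>k\<^sub>+\<^sub>1 \<phi>([[\<cdots>[x\<^sub>1, x\<^sub>2], \<cdots>], x\<^sub>p\<^sub>-\<^sub>k\<^sub>-\<^sub>1], x\<^sub>p\<^sub>-\<^sub>k)\<close>.
  The list index starts at 0, so \<open>x\<^sub>p\<^sub>-\<^sub>k\<close> is \<open>xs ! (p - k - 1)\<close>; in the outer \<open>foldl\<close>,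
  \<open>x\<^sub>p\<^sub>-\<^sub>k\<^sub>+\<^sub>1\<close> acts first and \<open>x\<^sub>p\<close> last.
\<close>

definition star_inner_sum ::
  "('k::field \<Rightarrow> 'l::ab_group_add \<Rightarrow> 'l) \<Rightarrow> ('l \<Rightarrow> 'l \<Rightarrow> 'l) \<Rightarrow> nat \<Rightarrow>
   ('l \<Rightarrow> 'l \<Rightarrow> 'l) \<Rightarrow> 'l list \<Rightarrow> 'l" where
  "star_inner_sum sL br p \<phi> xs =
     (\<Sum>k=0..p-2. sL ((- 1) ^ k)
        (foldl (\<lambda>v u. br u v)
           (\<phi> (foldl br (hd xs) (tl (take (p - k - 1) xs))) (xs ! (p - k - 1)))
           (drop (p - k) xs)))"

text \<open>
  The sequences with \<open>x\<^sub>i \<in> {x, y}\<close> are sequences of formal symbols (this matters when \<open>x = y\<close>):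
  they are encoded as boolean lists, with \<open>True\<close> for \<open>x\<close> and \<open>False\<close> for \<open>y\<close>.
\<close>

definition C2_star ::
  "('k::field \<Rightarrow> 'l::ab_group_add \<Rightarrow> 'l) \<Rightarrow> ('l \<Rightarrow> 'l \<Rightarrow> 'l) \<Rightarrow> nat \<Rightarrow>
   (('l \<Rightarrow> 'l \<Rightarrow> 'l) \<times> ('l \<Rightarrow> 'l)) set" where
  "C2_star sL br p = {(\<phi>, w). \<phi> \<in> C2_CE sL \<and>
     (\<forall>c x. w (sL c x) = sL (c ^ p) (w x)) \<and>
     (\<forall>x y. w (x + y) = w x + w y +
        (\<Sum>bs\<in>{bs::bool list. length bs = p \<and> bs ! 0 \<and> \<not> bs ! 1}.
           sL (inverse (of_nat (count_list bs True)))
             (star_inner_sum sL br p \<phi> (map (\<lambda>b. if b then x else y) bs))))}"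

definition ind2 ::
  "('k::field \<Rightarrow> 'l::ab_group_add \<Rightarrow> 'l) \<Rightarrow> ('l \<Rightarrow> 'l \<Rightarrow> 'l) \<Rightarrow> nat \<Rightarrow> ('l \<Rightarrow> 'l) \<Rightarrow>
   ('l \<Rightarrow> 'l \<Rightarrow> 'l) \<Rightarrow> ('l \<Rightarrow> 'l) \<Rightarrow> 'l \<Rightarrow> 'l \<Rightarrow> 'l" where
  "ind2 sL br p pm \<phi> w x y =
     \<phi> x (pm y)
     - (\<Sum>(i, j)\<in>{(i, j). i + j = p - 1}.
          sL ((- 1) ^ i) ((br y ^^ i) (\<phi> (((\<lambda>u. br u y) ^^ j) x) y)))
     + br x (w y)"

definition d2_star ::
  "('k::field \<Rightarrow> 'l::ab_group_add \<Rightarrow> 'l) \<Rightarrow> ('l \<Rightarrow> 'l \<Rightarrow> 'l) \<Rightarrow> nat \<Rightarrow> ('l \<Rightarrow> 'l) \<Rightarrow>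
   ('l \<Rightarrow> 'l \<Rightarrow> 'l) \<times> ('l \<Rightarrow> 'l) \<Rightarrow> ('l \<Rightarrow> 'l \<Rightarrow> 'l \<Rightarrow> 'l) \<times> ('l \<Rightarrow> 'l \<Rightarrow> 'l)" where
  "d2_star sL br p pm = (\<lambda>(\<phi>, w). (d2_CE br \<phi>, ind2 sL br p pm \<phi> w))"

end

theory Submission
  imports Defs
begin

text \<open>
  All three conditions are read off from the coefficient of \<open>t\<close> in the axioms of the deformation.
  That coefficient in a left-normed \<open>m\<^sub>t\<close>-bracket of \<open>x\<^sub>1, \<dots>, x\<^sub>n\<close> is the sum over the \<open>n - 1\<close> places
  where \<open>m\<^sub>1\<close> can replace the bracket of \<open>L\<close>. Expanding \<open>ad(Zx + y)\<^sup>p\<^sup>-\<^sup>1(x)\<close> into words in \<open>x\<close> and \<open>y\<close>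
  turns the Jacobson terms into such brackets: words with \<open>x\<^sub>2 = x\<close> vanish because \<open>m\<^sub>t\<close> alternates, the
  exponent of \<open>Z\<close> counts the letters \<open>x\<close> after the first, and passing from left to right
  multiplications costs no sign because \<open>p - 1\<close> is even.
\<close>

section \<open>Jacobson terms as sums over words\<close>

text \<open>Because \<open>m\<close> vanishes as soon as one argument is 0, the degree bounds in the
  double sum may be ignored, which leaves a Cauchy product.\<close>

lemma coeff_poly_extend:
  assumes "\<And>u. additive (m u)" and "\<And>v. additive (\<lambda>u. m u v)"
  shows "coeff (poly_extend m f g) n = (\<Sum>i\<le>n. m (coeff f i) (coeff g (n - i)))"
proof -
  have zero: "m u 0 = 0" "m 0 u = 0" for u
    using additive.zero[OF assms(1)[of u]] additive.zero[OF assms(2)[of u]] by auto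
  have inner: "(\<Sum>j\<le>degree g. if i + j = n then m (coeff f i) (coeff g j) else 0) =
    (if i \<le> n then m (coeff f i) (coeff g (n - i)) else 0)" for i
  proof (cases "i \<le> n")
    case True
    then have "(\<Sum>j\<le>degree g. if i + j = n then m (coeff f i) (coeff g j) else 0) =
      (\<Sum>j\<le>degree g. if j = n - i then m (coeff f i) (coeff g j) else 0)"
      by (intro sum.cong) auto
    then show ?thesis
      using True by (simp add: zero coeff_eq_0)
  qed (auto intro: sum.neutral)
  have "coeff (poly_extend m f g) n =
    (\<Sum>i\<le>degree f. if i \<le> n then m (coeff f i) (coeff g (n - i)) else 0)"
    by (simp add: poly_extend_def coeff_sum inner)
  also have "\<dots> = (\<Sum>i\<le>n. m (coeff f i) (coeff g (n - i)))"
    by (rule sum.mono_neutral_cong) (auto simp: zero coeff_eq_0)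
  finally show ?thesis .
qed

text \<open>The recursion behind the expansion into words: the letter \<open>y\<close> keeps the
  exponent of Z, the letter \<open>x\<close> raises it by one.\<close>

lemma coeff_poly_extend_linear:
  assumes "\<And>u. additive (m u)" and "\<And>v. additive (\<lambda>u. m u v)"
  shows "coeff (poly_extend m [:y, x:] g) n =
    m y (coeff g n) + (if n = 0 then 0 else m x (coeff g (n - 1)))"
proof (cases n)
  case (Suc k)
  have "m (coeff [:y, x:] (Suc (Suc i))) v = 0" for i v
    using additive.zero[OF assms(2)[of v]] by simp
  then show ?thesis
    by (cases k) (simp_all add: Suc coeff_poly_extend[OF assms] sum.atMost_Suc_shift
        del: sum.atMost_Suc)
qed (simp add: coeff_poly_extend[OF assms])

text \<open>The last letter is split off, not the first: \<open>foldl\<close> consumes it last, so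
  it belongs to the outermost of the \<open>Suc n\<close> applications of ad(Zx + y).\<close>

lemma sum_lists_length_Suc:
  "(\<Sum>bs | length bs = Suc n. g bs) =
    (\<Sum>bs | length bs = n. g (bs @ [True]) + g (bs @ [False]))"
proof -
  have fin: "finite {bs :: bool list. length bs = k}" for k
    using finite_lists_length_eq[of "UNIV :: bool set" k] by simp
  have split: "{bs :: bool list. length bs = Suc n} =
    (\<lambda>bs. bs @ [True]) ` {bs. length bs = n} \<union> (\<lambda>bs. bs @ [False]) ` {bs. length bs = n}"
  proof (intro equalityI subsetI)
    fix bs :: "bool list"
    assume "bs \<in> {bs. length bs = Suc n}"
    then obtain cs b where "bs = cs @ [b]" "length cs = n"
      by (cases bs rule: rev_cases) auto
    then show "bs \<in> (\<lambda>bs. bs @ [True]) ` {bs. length bs = n} \<union>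
        (\<lambda>bs. bs @ [False]) ` {bs. length bs = n}"
      by (cases b) auto
  qed auto
  have inj: "inj_on (\<lambda>bs. bs @ [b]) A" for b :: bool and A
    by (auto simp: inj_on_def)
  show ?thesis
    unfolding split
    by (subst sum.union_disjoint) (auto simp: fin sum.reindex[OF inj] sum.distrib)
qed

text \<open>A word records which summand of Zx + y each factor contributes, \<open>True\<close> for
  Zx and \<open>False\<close> for y; the innermost factor is the first letter.\<close>

lemma poly_extend_linear_funpow:
  assumes "\<And>u. additive (m u)" and "\<And>v. additive (\<lambda>u. m u v)"
  shows "(poly_extend m [:y, x:] ^^ n) [:z:] =
    (\<Sum>bs | length bs = n. monom (foldl (\<lambda>v b. m (if b then x else y) v) z bs) (count_list bs True))"
proof (induction n)
  case 0
  then show ?case by (simp add: monom_0)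
next
  case (Suc n)
  have zero: "m u 0 = 0" for u
    using additive.zero[OF assms(1)] .
  show ?case
  proof (rule poly_eqI)
    fix k
    show "coeff ((poly_extend m [:y, x:] ^^ Suc n) [:z:]) k =
      coeff (\<Sum>bs | length bs = Suc n.
        monom (foldl (\<lambda>v b. m (if b then x else y) v) z bs) (count_list bs True)) k"
      by (cases k) (simp_all add: Suc coeff_poly_extend_linear[OF assms] coeff_sum
          additive.sum[OF assms(1)] sum_lists_length_Suc sum.distrib if_distrib[of "m _"] zero
          add.commute cong: if_cong)
  qed
qed

text \<open>The words of length p - 1 from the expansion get an extra \<open>True\<close> in front
  for the starting vector \<open>x\<close>. A word with exponent i - 1 then has i letters x in all,
  so the factor 1/i becomes the inverse of that count. Since \<open>scale\<close> is only assumed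
  additive, scalars from F[[t]] are covered.\<close>

lemma sum_jacobson_term:
  assumes "\<And>u. additive (m u)" and "\<And>v. additive (\<lambda>u. m u v)"
    and "m x x = 0" and "\<And>c. additive (scale c)" and "p \<ge> 2"
  shows "(\<Sum>i=1..p-1. jacobson_term scale m p i x y) =
    (\<Sum>bs\<in>{bs. length bs = p \<and> bs ! 0 \<and> \<not> bs ! 1}.
      scale (inverse (of_nat (count_list bs True)))
        (foldl (\<lambda>v b. m (if b then x else y) v) x (tl bs)))"
proof -
  define F where "F = foldl (\<lambda>v b. m (if b then x else y) v) x"
  define W where "W = {bs :: bool list. length bs = p - 1}"
  have fin: "finite W"
    unfolding W_def using finite_lists_length_eq[of "UNIV :: bool set" "p - 1"] by simp
  have zero: "scale c 0 = 0" "m u 0 = 0" for c u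
    using additive.zero assms(1,4) by metis+
  \<comment> \<open>The innermost bracket is \<open>m x x\<close>, and all later ones preserve
    0.\<close>
  have F_True: "F (True # bs) = 0" for bs
    unfolding F_def by (induction bs rule: rev_induct) (auto simp: assms(3) zero)
  \<comment> \<open>A word starting with y has at most p - 2 letters x, so its only contributing
    index, one more than that number, lies in the range of the sum. The word with p - 1 letters x
    would need i = p, but its bracket is zero.\<close>
  have summand:
    "(\<Sum>i=1..p-1. scale (inverse (of_nat i)) (if count_list bs True = i - 1 then F bs else 0)) =
    (if hd bs then 0 else scale (inverse (of_nat (count_list (True # bs) True))) (F bs))"
    if bs: "bs \<in> W" for bs
  proof -
    obtain b cs where Cons: "bs = b # cs"
      using bs assms(5) by (cases bs) (auto simp: W_def)
    show ?thesis
    proof (cases b)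
      case True
      then show ?thesis
        using Cons F_True by (auto simp: zero intro: sum.neutral)
    next
      case False
      have len: "Suc (length cs) = p - 1"
        using bs Cons by (simp add: W_def)
      have "count_list cs True \<le> length cs"
        by (rule count_le_length)
      then have mem: "Suc (count_list cs True) \<in> {1..p - 1}"
        using len by simp
      have "(\<Sum>i=1..p-1. scale (inverse (of_nat i)) (if count_list bs True = i - 1 then F bs else 0)) =
        (\<Sum>i=1..p-1. if i = Suc (count_list cs True) then scale (inverse (of_nat i)) (F bs) else 0)"
        using Cons False by (intro sum.cong) (auto simp: zero)
      also have "\<dots> = scale (inverse (of_nat (Suc (count_list cs True)))) (F bs)"
        using mem by (subst sum.delta) auto
      finally show ?thesis
        using Cons False by simp
    qed
  qed
  have "(\<Sum>i=1..p-1. jacobson_term scale m p i x y) =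
    (\<Sum>i=1..p-1. \<Sum>bs\<in>W. scale (inverse (of_nat i)) (if count_list bs True = i - 1 then F bs else 0))"
    by (simp add: jacobson_term_def poly_extend_linear_funpow[OF assms(1,2)] coeff_sum
        additive.sum[OF assms(4)] F_def W_def cong: if_cong)
  also have "\<dots> =
    (\<Sum>bs\<in>W. if hd bs then 0 else scale (inverse (of_nat (count_list (True # bs) True))) (F bs))"
    by (subst sum.swap) (intro sum.cong summand refl)
  also have "\<dots> =
    (\<Sum>bs\<in>{bs \<in> W. \<not> hd bs}. scale (inverse (of_nat (count_list (True # bs) True))) (F bs))"
    by (intro sum.mono_neutral_cong_right fin) auto
  also have "\<dots> = (\<Sum>bs\<in>{bs. length bs = p \<and> bs ! 0 \<and> \<not> bs ! 1}.
      scale (inverse (of_nat (count_list bs True))) (F (tl bs)))"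
  proof (rule sum.reindex_bij_witness[of _ tl "Cons True"])
    fix bs assume "bs \<in> {bs \<in> W. \<not> hd bs}"
    then show "True # bs \<in> {bs. length bs = p \<and> bs ! 0 \<and> \<not> bs ! 1}"
      using assms(5) by (cases bs) (auto simp: W_def)
  next
    fix bs :: "bool list"
    assume bs: "bs \<in> {bs. length bs = p \<and> bs ! 0 \<and> \<not> bs ! 1}"
    then obtain b c cs where "bs = b # c # cs"
      using assms(5) by (cases bs; cases "tl bs") auto
    with bs show "True # tl bs = bs" "tl bs \<in> {bs \<in> W. \<not> hd bs}"
      by (auto simp: W_def)
  qed auto
  finally show ?thesis
    by (simp add: F_def)
qed

section \<open>Left-normed brackets in a deformation\<close>

text \<open>Each letter moved from one side to the other costs one sign.\<close>

lemma foldl_swap_antisymmetric: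
  assumes "\<And>u v. m u v = - m v u" and "\<And>v. additive (\<lambda>u. m u v)"
  shows "foldl (\<lambda>v u. m u v) z ys = (if even (length ys) then foldl m z ys else - foldl m z ys)"
proof (induction ys rule: rev_induct)
  case (snoc y ys)
  then show ?case
    using assms(1)[of y] additive.minus[OF assms(2)] by auto
qed simp

lemma bilinear_map_additive:
  assumes "bilinear_map scale m"
  shows "additive (m u)" and "additive (\<lambda>u. m u v)"
  using assms unfolding bilinear_map_def
  by (auto intro!: additive.intro simp: Vector_Spaces.linear_def module_hom_def module_hom_axioms_def)

lemma m_series_additive:
  assumes "\<And>i u. additive (ms i u)" and "\<And>i v. additive (\<lambda>u. ms i u v)"
  shows "additive (m_series ms f)" and "additive (\<lambda>f. m_series ms f g)"
  by (auto intro!: additive.intro fps_ext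
      simp: m_series_def additive.add[OF assms(1)] additive.add[OF assms(2)] sum.distrib)

lemma m_series_antisymmetric:
  assumes "\<And>i u v. ms i u v = - ms i v u"
  shows "m_series ms f g = - m_series ms g f"
proof (rule fps_ext)
  fix n
  have swap: "(\<Sum>j\<le>k. ms i (fps_nth f j) (fps_nth g (k - j))) =
    - (\<Sum>j\<le>k. ms i (fps_nth g j) (fps_nth f (k - j)))" for i k
  proof -
    have "(\<Sum>j\<le>k. ms i (fps_nth f j) (fps_nth g (k - j))) =
      (\<Sum>j\<le>k. ms i (fps_nth f (k - j)) (fps_nth g j))"
      by (rule sum.reindex_bij_witness[of _ "\<lambda>j. k - j" "\<lambda>j. k - j"]) auto
    also have "\<dots> = (\<Sum>j\<le>k. - ms i (fps_nth g j) (fps_nth f (k - j)))"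
      by (intro sum.cong refl assms)
    finally show ?thesis
      by (simp add: sum_negf)
  qed
  show "fps_nth (m_series ms f g) n = fps_nth (- m_series ms g f) n"
    unfolding m_series_def fps_nth_Abs_fps fps_neg_nth
    by (subst sum_negf[symmetric]) (intro sum.cong refl swap)
qed

lemma m_series_nth_01:
  "fps_nth (m_series ms f g) 0 = ms 0 (fps_nth f 0) (fps_nth g 0)"
  "fps_nth (m_series ms f g) 1 =
    ms 0 (fps_nth f 0) (fps_nth g 1) + ms 0 (fps_nth f 1) (fps_nth g 0) +
    ms 1 (fps_nth f 0) (fps_nth g 0)"
  by (simp_all add: m_series_def)

text \<open>A product rule. The letters are constant series, so a single factor t can only come from
  one use of \<open>ms 1\<close>; j is its place, with \<open>ms 0\<close> used before and after
  it.\<close>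

lemma foldl_m_series_nth_01:
  assumes "\<And>i u. additive (ms i u)" and "\<And>i v. additive (\<lambda>u. ms i u v)"
  shows "fps_nth (foldl (m_series ms) (fps_const x) (map fps_const ys)) 0 = foldl (ms 0) x ys"
    and "fps_nth (foldl (m_series ms) (fps_const x) (map fps_const ys)) 1 =
      (\<Sum>j<length ys. foldl (ms 0) (ms 1 (foldl (ms 0) x (take j ys)) (ys ! j)) (drop (Suc j) ys))"
proof -
  show const: "fps_nth (foldl (m_series ms) (fps_const x) (map fps_const ys)) 0 = foldl (ms 0) x ys"
    for ys
    by (induction ys rule: rev_induct) (simp_all add: m_series_nth_01)
  show "fps_nth (foldl (m_series ms) (fps_const x) (map fps_const ys)) 1 =
      (\<Sum>j<length ys. foldl (ms 0) (ms 1 (foldl (ms 0) x (take j ys)) (ys ! j)) (drop (Suc j) ys))"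
  proof (induction ys rule: rev_induct)
    case (snoc y ys)
    then show ?case
      by (simp add: m_series_nth_01[simplified] const additive.zero[OF assms(1)]
          additive.sum[OF assms(2)] nth_append)
  qed simp
qed

text \<open>Treats iterates of one multiplication as words with equal letters; with the arguments of
  \<open>f\<close> swapped this also covers left multiplication.\<close>

lemma funpow_eq_foldl_replicate: "((\<lambda>u. f u y) ^^ n) x = foldl f x (replicate n y)"
  by (induction n arbitrary: x) (simp_all add: funpow_Suc_right del: funpow.simps(2))

text \<open>Makes the scalars of the Jacobson terms over F[[t]] constant series, so that dividing by
  i acts on each coefficient of t separately.\<close>

lemma inverse_fps_of_nat: "inverse (of_nat n :: 'k::field fps) = fps_const (inverse (of_nat n))"
  by (simp add: fps_of_nat[symmetric] fps_const_inverse)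

lemma (in vector_space) fps_scale_const_nth:
  "fps_nth (fps_scale scale (fps_const c) f) n = scale c (fps_nth f n)"
proof -
  have "(\<Sum>i\<le>n. scale (fps_nth (fps_const c) i) (fps_nth f (n - i))) =
    (\<Sum>i\<le>n. if i = 0 then scale c (fps_nth f n) else 0)"
    by (intro sum.cong) auto
  then show ?thesis
    by (simp add: fps_scale_def)
qed

lemma (in vector_space) fps_scale_additive: "additive (fps_scale scale c)"
  by (auto intro!: additive.intro fps_ext simp: fps_scale_def scale_right_distrib sum.distrib)

lemma (in vector_space) scale_minus_one_power:
  "scale ((- 1) ^ n) v = (if even n then v else - v)"
  by simp

text \<open>Multiderivations are only required to be skew-symmetric, whereas 2-cochains must
  alternate; dividing by 2 bridges the two.\<close>

lemma (in vector_space) antisymmetric_imp_alternating: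
  fixes m :: "'b \<Rightarrow> 'b \<Rightarrow> 'b"
  assumes "CHAR('a) > 2" and "\<And>u v. m u v = - m v u"
  shows "m x x = 0"
proof -
  have "\<not> CHAR('a) dvd 2"
    using assms(1) dvd_imp_le[of "CHAR('a)" 2] by auto
  then have two: "(2 :: 'a) \<noteq> 0"
    using of_nat_eq_0_iff_char_dvd[where 'a = 'a, of 2] by simp
  have "m x x + m x x = 0"
    using assms(2)[of x x] by (metis add.left_inverse)
  then have "scale 2 (m x x) = 0"
    using scale_left_distrib[of 1 1 "m x x"] by simp
  then show ?thesis
    using two by simp
qed

text \<open>The k outer actions are left multiplications; turning them into right ones produces
  (-1)^k, which cancels the sign in the definition. The index is then reversed, j = p - 2 - k, to
  count places from the left as in \<open>foldl_m_series_nth_01\<close>.\<close>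

lemma (in vector_space) star_inner_sum_eq:
  assumes "\<And>u v. br u v = - br v u" and "\<And>v. additive (\<lambda>u. br u v)"
    and "length ys = p - 1" and "p \<ge> 2"
  shows "star_inner_sum scale br p \<phi> (x # ys) =
    (\<Sum>j<p - 1. foldl br (\<phi> (foldl br x (take j ys)) (ys ! j)) (drop (Suc j) ys))"
proof -
  define g where "g = (\<lambda>j. foldl br (\<phi> (foldl br x (take j ys)) (ys ! j)) (drop (Suc j) ys))"
  have "star_inner_sum scale br p \<phi> (x # ys) = (\<Sum>k<p - 1. g (p - 1 - Suc k))"
    unfolding star_inner_sum_def
  proof (rule sum.cong)
    fix k assume "k \<in> {..<p - 1}"
    then have k: "p - k - 1 = Suc (p - 1 - Suc k)" "p - k = Suc (Suc (p - 1 - Suc k))"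
      "length (drop (Suc (p - 1 - Suc k)) ys) = k"
      using assms(3) by auto
    show "scale ((- 1) ^ k) (foldl (\<lambda>v u. br u v)
        (\<phi> (foldl br (hd (x # ys)) (tl (take (p - k - 1) (x # ys)))) ((x # ys) ! (p - k - 1)))
        (drop (p - k) (x # ys))) = g (p - 1 - Suc k)"
      unfolding scale_minus_one_power k(1,2) foldl_swap_antisymmetric[OF assms(1,2)] g_def
      using k(3) by simp
  qed (use assms(4) in auto)
  also have "\<dots> = (\<Sum>j<p - 1. g j)"
    by (rule sum.nat_diff_reindex)
  finally show ?thesis
    by (simp add: g_def)
qed

section \<open>The infinitesimal of a restricted deformation\<close>

theorem theorem3p4:
  fixes sA :: "'k::field \<Rightarrow> 'a::comm_ring \<Rightarrow> 'a"
    and sL :: "'k \<Rightarrow> 'l::ab_group_add \<Rightarrow> 'l"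
    and act :: "'a \<Rightarrow> 'l \<Rightarrow> 'l"
    and br :: "'l \<Rightarrow> 'l \<Rightarrow> 'l"
    and pm :: "'l \<Rightarrow> 'l"
    and \<rho> :: "'l \<Rightarrow> 'a \<Rightarrow> 'a"
    and p :: nat
    and ms :: "nat \<Rightarrow> 'l \<Rightarrow> 'l \<Rightarrow> 'l"
    and ws :: "nat \<Rightarrow> 'l \<Rightarrow> 'l"
  assumes "CHAR('k) = p" and "p > 2"
    and "finite_dimensional sA" and "finite_dimensional sL"
    and "restricted_lie_rinehart_algebra sA sL act br p pm \<rho>"
    and "restricted_formal_deformation sA sL act p br pm \<rho> ms ws"
  shows "(ms 1, ws 1) \<in> C2_star sL br p \<and>
    d2_star sL br p pm (ms 1, ws 1) = (\<lambda>x y z. 0, \<lambda>x y. 0)"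
proof -
  interpret restricted_lie_rinehart_algebra sA sL act br p pm \<rho>
    by fact
  note deform = assms(6)[unfolded restricted_formal_deformation_def]
  have ms0: "ms 0 = br" and ws0: "ws 0 = pm"
    using deform by auto
  obtain \<sigma> where multi: "\<And>i. restricted_multiderivation sA sL act p (ms i) (ws i) (\<sigma> i)"
    using deform by auto
  have bil: "bilinear_map sL (ms i)" and anti: "ms i u v = - ms i v u"
    and hom: "ws i (sL c u) = sL (c ^ p) (ws i u)" for i u v c
    using multi[of i] unfolding restricted_multiderivation_def p_map_wrt_def by blast+
  note add = bilinear_map_additive[OF bil]
  note mt_add = m_series_additive[where ms = ms, OF add]
  note mt_anti = m_series_antisymmetric[where ms = ms, OF anti]
  have br_anti: "br u v = - br v u" for u v
    unfolding ms0[symmetric] by (rule anti)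
  have br_add: "additive (br u)" "additive (\<lambda>u. br u v)" for u v
    using add[of 0] ms0 by auto
  have alt: "ms i u u = 0" for i u
    using L.antisymmetric_imp_alternating[of "ms i" u] anti assms(1,2) by blast
  \<comment> \<open>Oddness of p leaves an even number p - 1 of letters after the first, so changing
    sides in the Jacobson words is free.\<close>
  have "prime p"
    using assms(1,2) prime_CHAR_semidom[where 'a = 'k] by simp
  then have "odd p"
    using assms(2) prime_odd_nat by blast

  \<comment> \<open>In every coefficient, each summand is some \<open>ms i\<close> either at two
    equal arguments or with an argument 0.\<close>
  have mt_alt: "m_series ms (fps_const u) (fps_const u) = 0" for u
  proof (rule fps_ext)
    fix n
    have "ms i (fps_nth (fps_const u) j) (fps_nth (fps_const u) k) = 0" for i j k
      using alt additive.zero[OF add(1)] additive.zero[OF add(2)] by auto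
    then show "fps_nth (m_series ms (fps_const u) (fps_const u)) n = fps_nth 0 n"
      by (simp add: m_series_def del: fps_nth_fps_const)
  qed

  \<comment> \<open>The coefficient of t in the additivity formula of \<Omega>, taken at constant
    series, whose sum is again constant.\<close>
  have "ws 1 (x + y) = ws 1 x + ws 1 y +
      (\<Sum>bs\<in>{bs::bool list. length bs = p \<and> bs ! 0 \<and> \<not> bs ! 1}.
        sL (inverse (of_nat (count_list bs True)))
          (star_inner_sum sL br p (ms 1) (map (\<lambda>b. if b then x else y) bs)))" for x y
  proof -
    obtain \<Omega> where \<Omega>: "\<And>x. \<Omega> (fps_const x) = w_series ws x"
      "p_map_wrt (fps_scale sL) (m_series ms) p \<Omega>"
      using deform by auto
    have "w_series ws (x + y) = w_series ws x + w_series ws y +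
      (\<Sum>i=1..p-1. jacobson_term (fps_scale sL) (m_series ms) p i (fps_const x) (fps_const y))"
      using \<Omega> unfolding p_map_wrt_def by (metis fps_const_add)
    then have "fps_nth (w_series ws (x + y)) 1 = fps_nth (w_series ws x + w_series ws y +
      (\<Sum>i=1..p-1. jacobson_term (fps_scale sL) (m_series ms) p i (fps_const x) (fps_const y))) 1"
      by simp
    also have "\<dots> = ws 1 x + ws 1 y +
      (\<Sum>bs\<in>{bs. length bs = p \<and> bs ! 0 \<and> \<not> bs ! 1}.
        sL (inverse (of_nat (count_list bs True)))
          (fps_nth (foldl (\<lambda>v b. m_series ms (if b then fps_const x else fps_const y) v)
            (fps_const x) (tl bs)) 1))"
      unfolding sum_jacobson_term[OF mt_add mt_alt L.fps_scale_additive less_imp_le[OF assms(2)]]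
      by (simp add: w_series_def fps_sum_nth inverse_fps_of_nat L.fps_scale_const_nth)
    also have "\<dots> = ws 1 x + ws 1 y +
      (\<Sum>bs\<in>{bs. length bs = p \<and> bs ! 0 \<and> \<not> bs ! 1}.
        sL (inverse (of_nat (count_list bs True)))
          (star_inner_sum sL br p (ms 1) (map (\<lambda>b. if b then x else y) bs)))"
    proof (intro arg_cong2[of _ _ _ _ "(+)"] sum.cong refl arg_cong[of _ _ "sL _"])
      fix bs :: "bool list"
      assume "bs \<in> {bs. length bs = p \<and> bs ! 0 \<and> \<not> bs ! 1}"
      then obtain cs where bs: "bs = True # cs" "length cs = p - 1"
        using assms(2) by (cases bs) auto
      define ys where "ys = map (\<lambda>b. if b then x else y) cs"
      have ys: "length ys = p - 1" "even (length (map fps_const ys))"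
        using bs \<open>odd p\<close> by (auto simp: ys_def)
      have "foldl (\<lambda>v b. m_series ms (if b then fps_const x else fps_const y) v) z cs =
        foldl (\<lambda>v u. m_series ms u v) z (map fps_const ys)" for z
        unfolding ys_def by (induction cs arbitrary: z) auto
      also have "foldl (\<lambda>v u. m_series ms u v) (fps_const x) (map fps_const ys) =
        foldl (m_series ms) (fps_const x) (map fps_const ys)"
        unfolding foldl_swap_antisymmetric[where m = "m_series ms", OF mt_anti mt_add(2)] using ys(2) by simp
      finally show "fps_nth (foldl (\<lambda>v b. m_series ms (if b then fps_const x else fps_const y) v)
            (fps_const x) (tl bs)) 1 =
          star_inner_sum sL br p (ms 1) (map (\<lambda>b. if b then x else y) bs)"
        using foldl_m_series_nth_01(2)[where ms = ms, OF add, of x ys] assms(2) ys(1)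
          L.star_inner_sum_eq[where br = br, OF br_anti br_add(2) ys(1)]
        by (simp add: bs ms0 ys_def)
    qed
    finally show ?thesis
      by (simp add: w_series_def)
  qed
  then have "(ms 1, ws 1) \<in> C2_star sL br p"
    using bil alt hom by (simp add: C2_star_def C2_CE_def)

  moreover have "d2_CE br (ms 1) x y z = 0" for x y z
  proof -
    have "fps_nth (m_series ms (fps_const x) (m_series ms (fps_const y) (fps_const z)) +
        m_series ms (fps_const y) (m_series ms (fps_const z) (fps_const x)) +
        m_series ms (fps_const z) (m_series ms (fps_const x) (fps_const y))) 1 = fps_nth 0 1"
      using deform by metis
    \<comment> \<open>Each summand of the Jacobi identity gives two terms; by skew-symmetry the six
      add up to \<open>- d2_CE br (ms 1) x y z\<close>.\<close>
    then have "br x (ms 1 y z) + ms 1 x (br y z) + (br y (ms 1 z x) + ms 1 y (br z x)) +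
        (br z (ms 1 x y) + ms 1 z (br x y)) = 0"
      by (simp add: m_series_nth_01[simplified] ms0 additive.zero[OF br_add(1)]
          additive.zero[OF br_add(2)])
    moreover have "ms 1 y (br z x) = ms 1 (br x z) y"
      using anti[of 1 y "br z x"] br_anti[of z x] additive.minus[OF add(2)] by simp
    moreover have "br y (ms 1 z x) = - br y (ms 1 x z)"
      using anti[of 1 z x] additive.minus[OF br_add(1)] by simp
    ultimately show ?thesis
      using anti[of 1 x "br y z"] anti[of 1 z "br x y"]
      by (simp add: d2_CE_def algebra_simps)
  qed

  moreover have "ind2 sL br p pm (ms 1) (ws 1) x y = 0" for x y
  proof -
    \<comment> \<open>The left side supplies the terms of \<open>ind2\<close> with
      \<open>pm y\<close> and \<open>ws 1 y\<close>; the right side becomes its alternating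
      sum.\<close>
    have "fps_nth (m_series ms (fps_const x) (w_series ws y)) 1 =
      fps_nth (((\<lambda>u. m_series ms u (fps_const y)) ^^ p) (fps_const x)) 1"
      using deform by metis
    also have "((\<lambda>u. m_series ms u (fps_const y)) ^^ p) (fps_const x) =
      foldl (m_series ms) (fps_const x) (map fps_const (replicate p y))"
      by (simp add: funpow_eq_foldl_replicate)
    also have "fps_nth \<dots> 1 =
      (\<Sum>j<p. ((\<lambda>u. br u y) ^^ (p - Suc j)) (ms 1 (((\<lambda>u. br u y) ^^ j) x) y))"
      unfolding foldl_m_series_nth_01(2)[where ms = ms, OF add] ms0
      by (auto simp: funpow_eq_foldl_replicate min_def intro!: sum.cong)
    also have "\<dots> = (\<Sum>(i, j)\<in>{(i, j). i + j = p - 1}.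
          sL ((- 1) ^ i) ((br y ^^ i) (ms 1 (((\<lambda>u. br u y) ^^ j) x) y)))"
    \<comment> \<open>With j right multiplications by y before \<open>ms 1\<close>, there remain i =
      p - 1 - j after it. The sign (-1)^i in \<open>ind2\<close> is exactly the cost of writing
      those i as left multiplications.\<close>
    proof (rule sum.reindex_bij_witness[of _ snd "\<lambda>j. (p - Suc j, j)"])
      fix j assume "j \<in> {..<p}"
      have "(br y ^^ i) v = foldl (\<lambda>v u. br u v) v (replicate i y)" for i v
        by (rule funpow_eq_foldl_replicate[where f = "\<lambda>v u. br u v"])
      then have "sL ((- 1) ^ i) ((br y ^^ i) v) = ((\<lambda>u. br u y) ^^ i) v" for i v
        by (simp add: L.scale_minus_one_power foldl_swap_antisymmetric[where m = br, OF br_anti br_add(2)]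
            funpow_eq_foldl_replicate)
      then show "(case (p - Suc j, j) of (i, j) \<Rightarrow>
          sL ((- 1) ^ i) ((br y ^^ i) (ms 1 (((\<lambda>u. br u y) ^^ j) x) y))) =
        ((\<lambda>u. br u y) ^^ (p - Suc j)) (ms 1 (((\<lambda>u. br u y) ^^ j) x) y)"
        by simp
    qed (use assms(2) in auto)
    finally show ?thesis
      by (simp add: ind2_def m_series_nth_01[simplified] w_series_def ms0 ws0
          additive.zero[OF br_add(2)] add.commute add_diff_eq)
  qed

  ultimately show ?thesis
    by (simp add: d2_star_def fun_eq_iff)
qed

end
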